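(* Let $A\in\mathcal M_n(\mathbb R)$ be a square matrix and $b\in\mathbb R^n$. Suppose that $x^\sharp\in\mathrm{Ls}_{p\to\infty}\{x\in\mathbb R^n:A\stackrel{p}{\cdot}x=b\}$. Then $x^\sharp$ is a solution of the system $$\begin{cases}A\stackrel{-}{\boxtimes}x\le b\\ A\stackrel{+}{\boxtimes}x\ge b,\end{cases}\qquad x\in\mathbb R^n.$$ Moreover, if $|A|_\infty\ne0$ then $x^\star=\sum_{i\in[n]}\frac{|A^{(i)}|_\infty}{|A|_\infty}e_i$ is a solution of this system.
   Context: $[n]=\{1,\dots,n\}$; $(e_i)$ is the canonical basis; vector inequalities are componentwise; $t^{1/(2p+1)}$ is the real odd root. For a natural number $p$, $A\stackrel{p}{\cdot}x$ is the vector with components $(\sum_{j}a_{i,j}^{2p+1}x_j^{2p+1})^{1/(2p+1)}$. $A^{(i)}$ is the matrix obtained from $A$ by replacing column $i$ with $b$. $\mathrm{Ls}_pA_p$ is the Kuratowski–Painlevé upper limit: the set of limits of sequences $x^{(p_k)}\in A_{p_k}$ along subsequences $(p_k)$. Binary associative operations on $\mathbb R$: $u\stackrel{\mp}{\smile}v$ equals $u$ if $|u|>|v|$, equals $v$ if $|u|<|v|$, and if $|u|=|v|$ then $u\stackrel{-}{\smile}v=\min\{u,v\}$, $u\stackrel{+}{\smile}v=\max\{u,v\}$. $A\stackrel{-}{\boxtimes}x$ and $A\stackrel{+}{\boxtimes}x$ are the vectors with $i$-th components $a_{i,1}x_1\stackrel{-}{\smile}\cdots\stackrel{-}{\smile}a_{i,n}x_n$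 and $a_{i,1}x_1\stackrel{+}{\smile}\cdots\stackrel{+}{\smile}a_{i,n}x_n$ respectively. Determinant in limit: $|A|_\infty=\mathop{\boxplus}_{\sigma\in S_n}\big(\operatorname{sgn}(\sigma)\prod_{i\in[n]}a_{i,\sigma(i)}\big)$, where for a finite family of reals $(x_i)_{i\in I}$, with $\xi(\alpha)=\mathrm{Card}\{i:x_i=\alpha\}-\mathrm{Card}\{i:x_i=-\alpha\}$ for $\alpha>0$: $\mathop{\boxplus}_{i\in I}x_i=0$ if $\xi(\alpha)=0$ for all $\alpha>0$; otherwise, with $\alpha^\star$ the largest $\alpha>0$ such that $\xi(\alpha)\ne0$, $\mathop{\boxplus}_{i\in I}x_i=\alpha^\star$ if $\xi(\alpha^\star)>0$ and $-\alpha^\star$ if $\xi(\alpha^\star)<0$. *)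

theory Defs
  imports "HOL-Analysis.Analysis"
begin

definition Ls :: "(nat \<Rightarrow> 'a::topological_space set) \<Rightarrow> 'a set" where
  "Ls S = {x. \<exists>r s. strict_mono (r :: nat \<Rightarrow> nat) \<and> (\<forall>k. s k \<in> S (r k)) \<and> s \<longlonglongrightarrow> x}"

text \<open>\<open>root m\<close> for odd \<open>m\<close> is the odd real root, also on negative arguments.\<close>

definition pmult :: "nat \<Rightarrow> real^'n^'m \<Rightarrow> real^'n \<Rightarrow> real^'m" where
  "pmult p A x =
     (\<chi> i. root (2*p+1) (\<Sum>j\<in>UNIV. (A $ i $ j) ^ (2*p+1) * (x $ j) ^ (2*p+1)))"

definition smile_minus :: "real \<Rightarrow> real \<Rightarrow> real" where
  "smile_minus u v =
     (if \<bar>u\<bar> > \<bar>v\<bar> then u else if \<bar>u\<bar> < \<bar>v\<bar> then v else min u v)"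

definition smile_plus :: "real \<Rightarrow> real \<Rightarrow> real" where
  "smile_plus u v =
     (if \<bar>u\<bar> > \<bar>v\<bar> then u else if \<bar>u\<bar> < \<bar>v\<bar> then v else max u v)"

text \<open>Both operations are associative and commutative with unit 0, so iterating them over
  a finite index type needs neither an order on the indices nor a bracketing.\<close>

interpretation smile_minus: comm_monoid_set smile_minus 0
  by standard (auto simp: smile_minus_def min_def abs_if split: if_splits)

interpretation smile_plus: comm_monoid_set smile_plus 0
  by standard (auto simp: smile_plus_def max_def abs_if split: if_splits)

definition box_minus :: "real^'n^'m \<Rightarrow> real^'n \<Rightarrow> real^'m" where
  "box_minus A x = (\<chi> i. smile_minus.F (\<lambda>j. A $ i $ j * x $ j) UNIV)"

definition box_plus :: "real^'n^'m \<Rightarrow> real^'n \<Rightarrow> real^'m" where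
  "box_plus A x = (\<chi> i. smile_plus.F (\<lambda>j. A $ i $ j * x $ j) UNIV)"

definition balance :: "('i \<Rightarrow> real) \<Rightarrow> 'i set \<Rightarrow> real \<Rightarrow> int" where
  "balance f I \<alpha> = int (card {i \<in> I. f i = \<alpha>}) - int (card {i \<in> I. f i = - \<alpha>})"

text \<open>For finite \<open>I\<close> only finitely many \<open>\<alpha>\<close> have nonzero balance, so the maximum exists
  as soon as there is one.\<close>

definition boxsum :: "('i \<Rightarrow> real) \<Rightarrow> 'i set \<Rightarrow> real" where
  "boxsum f I =
     (if \<forall>\<alpha>>0. balance f I \<alpha> = 0 then 0
      else let \<alpha> = Max {\<alpha>. \<alpha> > 0 \<and> balance f I \<alpha> \<noteq> 0}
           in if balance f I \<alpha> > 0 then \<alpha> else - \<alpha>)"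

definition det_inf :: "real^'n^'n \<Rightarrow> real" where
  "det_inf A =
     boxsum (\<lambda>\<sigma>. of_int (sign \<sigma>) * (\<Prod>i\<in>UNIV. A $ i $ \<sigma> i)) {\<sigma>. \<sigma> permutes UNIV}"

definition replace_col :: "real^'n^'m \<Rightarrow> 'n \<Rightarrow> real^'m \<Rightarrow> real^'n^'m" where
  "replace_col A i b = (\<chi> k j. if j = i then b $ k else A $ k $ j)"

end

theory Submission
  imports Defs
begin

text \<open>
  For odd exponents \<open>m = 2 * p + 1\<close> the map \<open>t \<mapsto> t ^ m\<close> is an increasing bijection of the reals
  that fixes signs, so \<open>pmult p A x = b\<close> is the ordinary linear system with all entries of
  \<open>A\<close>, \<open>x\<close> and \<open>b\<close> raised to the power \<open>m\<close>.  The theorem describes what survives of these systems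
  as \<open>m\<close> tends to infinity, when every sum is governed by its terms of largest absolute value.

  First claim.  Consider one row, \<open>\<Sum>j. c k j ^ m k = b ^ m k\<close> with \<open>c k j\<close> tending to \<open>c j\<close>.
  Let \<open>v\<close> be the \<open>smile_minus\<close>-sum of the \<open>c j\<close>.  If \<open>v > 0\<close>, then \<open>v\<close> is the largest absolute
  value and \<open>- v\<close> is not among the \<open>c j\<close>, so no cancellation at the top level is possible and
  \<open>b < v\<close> would make the left-hand side too large by an exponential factor.  If \<open>v \<le> 0\<close>, then no
  \<open>c j\<close> lies below \<open>v\<close>, so a value \<open>b < v\<close> would make \<open>b ^ m k\<close> a negative number reached by
  boundedly many negative terms of exponentially smaller size.  Hence \<open>v \<le> b\<close> (\<open>limit_row_smile_minus_le\<close>).  The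
  inequality for \<open>smile_plus\<close> is the same one after changing all signs.

  Second claim.  In \<open>\<Sum>i. f i ^ m\<close> opposite terms cancel, and after collecting equal absolute values
  the dominating one is the \<open>boxsum\<close>; so the \<open>m\<close>-th root of the sum tends to \<open>boxsum f\<close>
  (\<open>root_power_sum_tendsto_boxsum\<close>).  Applied to the Leibniz formula, the \<open>m\<close>-th root of the
  determinant of the powered matrix tends to \<open>det_inf A\<close>.  If that limit is nonzero,
  Cramer's rule solves the powered systems for all large \<open>p\<close>, and the \<open>m\<close>-th roots of the solutions
  tend to the vector of quotients of limit determinants.  This vector therefore lies in the
  upper limit of the solution sets, and the first claim applies to it.
\<close>

section \<open>Iterated operations on finite families\<close>

text \<open>The last condition records how ties are resolved: two values of equal largest absolute value
  and opposite signs give the negative one, so a positive result excludes its opposite.\<close>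

lemma smile_minus_F_characterization:
  assumes "finite I"
  shows "(\<forall>j\<in>I. \<bar>c j\<bar> \<le> \<bar>smile_minus.F c I\<bar>)
    \<and> (smile_minus.F c I = 0 \<or> smile_minus.F c I \<in> c ` I)
    \<and> (smile_minus.F c I > 0 \<longrightarrow> (\<forall>j\<in>I. c j \<noteq> - smile_minus.F c I))"
  using assms
proof (induction I rule: finite_induct)
  case empty
  then show ?case by simp
next
  case (insert i I)
  define v where "v = smile_minus.F c I"
  have F: "smile_minus.F c (insert i I) = smile_minus (c i) v"
    using insert by (simp add: v_def)
  have *: "\<And>j. j \<in> I \<Longrightarrow> \<bar>c j\<bar> \<le> \<bar>v\<bar>" "v = 0 \<or> v \<in> c ` I" "\<And>j. v > 0 \<Longrightarrow> j \<in> I \<Longrightarrow> c j \<noteq> - v"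
    using insert.IH by (auto simp: v_def)
  consider "\<bar>c i\<bar> > \<bar>v\<bar>" | "\<bar>c i\<bar> < \<bar>v\<bar>" | "c i = v" | "c i = - v" "v \<noteq> 0"
    by linarith
  then show ?case
  proof cases
    case 1
    then have "smile_minus.F c (insert i I) = c i" by (simp add: F smile_minus_def)
    with 1 *(1) show ?thesis by force
  next
    case 2
    then have "smile_minus.F c (insert i I) = v" by (simp add: F smile_minus_def)
    with 2 * show ?thesis by auto
  next
    case 3
    then have "smile_minus.F c (insert i I) = v" by (simp add: F smile_minus_def)
    with 3 * show ?thesis by auto
  next
    case 4
    then have "smile_minus.F c (insert i I) = - \<bar>v\<bar>"
      by (auto simp: F smile_minus_def min_def)
    with 4 * show ?thesis by (auto simp: abs_if)
  qed
qed

lemma smile_plus_F_eq_uminus: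
  assumes "finite I"
  shows "smile_plus.F c I = - smile_minus.F (\<lambda>j. - c j) I"
  using assms
proof (induction I rule: finite_induct)
  case (insert i I)
  have "smile_plus u v = - smile_minus (- u) (- v)" for u v
    by (simp add: smile_plus_def smile_minus_def min_def max_def)
  with insert show ?case by simp
qed simp

section \<open>Rows of limits of solutions\<close>

lemma eventually_mult_power_less_power:
  fixes s t C :: real
  assumes "0 < t" "t < s" and m: "filterlim m at_top F"
  shows "\<forall>\<^sub>F k in F. C * t ^ m k < s ^ m k"
proof -
  have "(\<lambda>n. (t / s) ^ n) \<longlonglongrightarrow> 0"
    using assms by (intro LIMSEQ_realpow_zero) auto
  then have "((\<lambda>k. (t / s) ^ m k) \<longlongrightarrow> 0) F"
    using m by (rule filterlim_compose)
  then have "((\<lambda>k. C * (t / s) ^ m k) \<longlongrightarrow> 0) F"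
    by (rule tendsto_mult_right_zero)
  then have "\<forall>\<^sub>F k in F. C * (t / s) ^ m k < 1"
    by (rule order_tendstoD) simp
  then show ?thesis
    by eventually_elim (use assms in \<open>simp add: power_divide pos_divide_less_eq\<close>)
qed


text \<open>In both cases a number \<open>b < v\<close> yields reals \<open>0 < t < s\<close> and a bound \<open>s ^ m \<le> C * t ^ m\<close> with
  \<open>C\<close> independent of \<open>m\<close>.  For \<open>v > 0\<close> some term eventually exceeds \<open>s\<close>, and all
  negative terms as well as \<open>b\<close> are dominated by \<open>t\<close>; for \<open>v \<le> 0\<close> one takes \<open>s = - b\<close>.\<close>

lemma limit_row_smile_minus_le:
  fixes c :: "nat \<Rightarrow> 'i::finite \<Rightarrow> real"
  assumes lim: "\<And>j. (\<lambda>k. c k j) \<longlonglongrightarrow> d j"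
    and odd: "\<And>k. odd (m k)" and m: "filterlim m at_top sequentially"
    and sum_eq: "\<And>k. (\<Sum>j\<in>UNIV. c k j ^ m k) = b ^ m k"
  shows "smile_minus.F d UNIV \<le> b"
proof (rule ccontr)
  define v where "v = smile_minus.F d UNIV"
  assume "\<not> smile_minus.F d UNIV \<le> b"
  then have bv: "b < v" by (simp add: v_def)
  have v_bound: "\<And>j. \<bar>d j\<bar> \<le> \<bar>v\<bar>" and v_mem: "v = 0 \<or> v \<in> range d"
    and v_no_tie: "\<And>j. v > 0 \<Longrightarrow> d j \<noteq> - v"
    using smile_minus_F_characterization[of UNIV d] by (auto simp: v_def)
  define N where "N = real CARD('i)"
  have minus_pow: "(- t) ^ m k = - (t ^ m k)" for t :: real and k
    using odd by (simp add: power_minus_odd)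
  have mono: "x ^ m k \<le> y ^ m k" if "x \<le> y" for x y :: real and k
    using odd that by (simp add: power_mono_odd)
  show False
  proof (cases "v > 0")
    case True
    then obtain j0 where j0: "d j0 = v" using v_mem by auto
    have above: "- v < d j" for j
      using v_bound[of j] v_no_tie[OF True, of j] True by (auto simp: abs_if split: if_splits)
    (* B bounds b and the size of every negative limit; by finiteness it stays strictly below v,
       which leaves room for t and s. *)
    define B where "B = Max (insert 0 (insert b (range (\<lambda>j. - d j))))"
    have B: "0 \<le> B" "b \<le> B" "\<And>j. - d j \<le> B"
      unfolding B_def by (rule Max_ge; simp)+
    have "B < v"
      using True bv above by (auto simp: B_def minus_less_iff)
    then obtain t where t: "B < t" "t < v" using dense by blast
    then obtain s where s: "t < s" "s < v" using dense by blast
    have "\<forall>\<^sub>F k in sequentially. \<forall>j. - t < c k j"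
    proof (rule eventually_all_finite)
      fix j
      have "- t < d j" using B(3)[of j] t by linarith
      then show "\<forall>\<^sub>F k in sequentially. - t < c k j" by (rule order_tendstoD[OF lim])
    qed
    moreover have "\<forall>\<^sub>F k in sequentially. s < c k j0"
      using order_tendstoD(1)[OF lim[of j0]] j0 s by simp
    moreover have "\<forall>\<^sub>F k in sequentially. (N + 1) * t ^ m k < s ^ m k"
      using eventually_mult_power_less_power[OF _ s(1) m] B t by simp
    ultimately have "\<forall>\<^sub>F k in sequentially. False"
    proof eventually_elim
      case (elim k)
      have "s ^ m k = (\<Sum>j\<in>UNIV. if j = j0 then s ^ m k else 0)" by simp
      also have "\<dots> \<le> (\<Sum>j\<in>UNIV. c k j ^ m k + t ^ m k)"
      proof (rule sum_mono)
        fix j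
        have "c k j ^ m k + t ^ m k \<ge> 0"
          using mono[of "- t" "c k j" k] elim(1) by (simp add: minus_pow less_imp_le)
        moreover have "c k j0 ^ m k + t ^ m k \<ge> s ^ m k"
          using mono[of s "c k j0" k] elim(2) B t by (simp add: add_increasing2)
        ultimately show "(if j = j0 then s ^ m k else 0) \<le> c k j ^ m k + t ^ m k" by auto
      qed
      also have "\<dots> = b ^ m k + N * t ^ m k"
        by (simp add: sum.distrib sum_eq N_def)
      also have "\<dots> \<le> (N + 1) * t ^ m k"
        using mono[of b t k] B t by (simp add: algebra_simps)
      finally show False using elim(3) by simp
    qed
    then show False by simp
  next
    case False
    obtain t' where t': "b < t'" "t' < v" using dense[OF bv] by blast
    define t where "t = - t'"
    have t: "0 < t" "t < - b" "- t < v" using t' False by (auto simp: t_def)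
    have "\<forall>\<^sub>F k in sequentially. \<forall>j. - t < c k j"
    proof (rule eventually_all_finite)
      fix j
      have "- t < d j" using v_bound[of j] False t by linarith
      then show "\<forall>\<^sub>F k in sequentially. - t < c k j" by (rule order_tendstoD[OF lim])
    qed
    moreover have "\<forall>\<^sub>F k in sequentially. N * t ^ m k < (- b) ^ m k"
      by (rule eventually_mult_power_less_power[OF t(1,2) m])
    ultimately have "\<forall>\<^sub>F k in sequentially. False"
    proof eventually_elim
      case (elim k)
      have "(\<Sum>j\<in>(UNIV::'i set). (- t) ^ m k) \<le> (\<Sum>j\<in>UNIV. c k j ^ m k)"
        using elim(1) by (intro sum_mono mono) (simp add: less_imp_le)
      then show False using elim(2) by (simp add: sum_eq N_def minus_pow)
    qed
    then show False by simp
  qed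
qed

lemma limit_row_smile_plus_ge:
  fixes c :: "nat \<Rightarrow> 'i::finite \<Rightarrow> real"
  assumes "\<And>j. (\<lambda>k. c k j) \<longlonglongrightarrow> d j"
    and "\<And>k. odd (m k)" and "filterlim m at_top sequentially"
    and "\<And>k. (\<Sum>j\<in>UNIV. c k j ^ m k) = b ^ m k"
  shows "b \<le> smile_plus.F d UNIV"
proof -
  have "smile_minus.F (\<lambda>j. - d j) UNIV \<le> - b"
    by (rule limit_row_smile_minus_le[where c = "\<lambda>k j. - c k j" and m = m])
      (use assms in \<open>auto intro: tendsto_minus simp: power_minus_odd sum_negf\<close>)
  then show ?thesis by (simp add: smile_plus_F_eq_uminus)
qed

lemma pmult_eq_iff:
  "pmult p A x = b \<longleftrightarrow>
    (\<forall>i. (\<Sum>j\<in>UNIV. (A $ i $ j) ^ (2*p+1) * (x $ j) ^ (2*p+1)) = (b $ i) ^ (2*p+1))"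
proof -
  have "root (2*p+1) y = z \<longleftrightarrow> y = z ^ (2*p+1)" for y z :: real
    using odd_real_root_pow[of "2*p+1" y] odd_real_root_power_cancel[of "2*p+1" z] by auto
  then show ?thesis by (simp add: pmult_def vec_eq_iff)
qed

lemma Ls_pmult_solutions_imp_box_system:
  fixes A :: "real^'n^'m"
  assumes "x \<in> Ls (\<lambda>p. {x. pmult p A x = b})"
  shows "box_minus A x \<le> b \<and> b \<le> box_plus A x"
proof -
  obtain r s where r: "strict_mono (r :: nat \<Rightarrow> nat)" and s: "\<And>k. pmult (r k) A (s k) = b"
    and lim: "s \<longlonglongrightarrow> x"
    using assms by (auto simp: Ls_def)
  have m: "filterlim (\<lambda>k. 2 * r k + 1) at_top sequentially"
  proof (rule filterlim_at_top_mono[OF filterlim_subseq[OF r]])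
    show "\<forall>\<^sub>F k in sequentially. r k \<le> 2 * r k + 1" by (intro always_eventually) auto
  qed
  have rows: "(\<lambda>k. A $ i $ j * s k $ j) \<longlonglongrightarrow> A $ i $ j * x $ j" for i j
    using lim by (intro tendsto_intros)
  have sums: "(\<Sum>j\<in>UNIV. (A $ i $ j * s k $ j) ^ (2 * r k + 1)) = b $ i ^ (2 * r k + 1)" for i k
    using s[of k] by (simp only: pmult_eq_iff power_mult_distrib)
  have "smile_minus.F (\<lambda>j. A $ i $ j * x $ j) UNIV \<le> b $ i" for i
    by (rule limit_row_smile_minus_le[OF rows _ m sums]) simp
  moreover have "b $ i \<le> smile_plus.F (\<lambda>j. A $ i $ j * x $ j) UNIV" for i
    by (rule limit_row_smile_plus_ge[OF rows _ m sums]) simp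
  ultimately show ?thesis
    by (simp add: less_eq_vec_def box_minus_def box_plus_def)
qed

section \<open>Roots of sums of high odd powers\<close>

lemma finite_nonzero_balance:
  assumes "finite I"
  shows "finite {\<alpha>. \<alpha> > 0 \<and> balance f I \<alpha> \<noteq> 0}"
proof (rule finite_subset)
  show "{\<alpha>. \<alpha> > 0 \<and> balance f I \<alpha> \<noteq> 0} \<subseteq> (\<lambda>i. \<bar>f i\<bar>) ` I"
  proof
    fix \<alpha> assume "\<alpha> \<in> {\<alpha>. \<alpha> > 0 \<and> balance f I \<alpha> \<noteq> 0}"
    then have \<alpha>: "\<alpha> > 0" "balance f I \<alpha> \<noteq> 0" by auto
    then have "{i \<in> I. f i = \<alpha>} \<noteq> {} \<or> {i \<in> I. f i = - \<alpha>} \<noteq> {}"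
      unfolding balance_def by (metis card.empty diff_self)
    then obtain i where "i \<in> I" "f i = \<alpha> \<or> f i = - \<alpha>" by blast
    with \<alpha>(1) show "\<alpha> \<in> (\<lambda>i. \<bar>f i\<bar>) ` I" by (intro image_eqI[of _ _ i]) auto
  qed
  show "finite ((\<lambda>i. \<bar>f i\<bar>) ` I)" using assms by simp
qed

lemma sum_odd_power_eq_sum_balance:
  fixes f :: "'i \<Rightarrow> real"
  assumes "finite I" "odd m"
  shows "(\<Sum>i\<in>I. f i ^ m) =
    (\<Sum>\<alpha> | \<alpha> > 0 \<and> balance f I \<alpha> \<noteq> 0. of_int (balance f I \<alpha>) * \<alpha> ^ m)"
proof -
  let ?P = "{\<alpha>. \<alpha> > 0 \<and> balance f I \<alpha> \<noteq> 0}"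
  let ?T = "(\<lambda>i. \<bar>f i\<bar>) ` I"
  have level: "(\<Sum>i | i \<in> I \<and> \<bar>f i\<bar> = \<alpha>. f i ^ m) =
    (if \<alpha> > 0 then of_int (balance f I \<alpha>) * \<alpha> ^ m else 0)" if "\<alpha> \<in> ?T" for \<alpha>
  proof (cases "\<alpha> > 0")
    case True
    have "{i \<in> I. \<bar>f i\<bar> = \<alpha>} = {i \<in> I. f i = \<alpha>} \<union> {i \<in> I. f i = - \<alpha>}"
      using True by (auto simp: abs_if split: if_splits)
    moreover have "{i \<in> I. f i = \<alpha>} \<inter> {i \<in> I. f i = - \<alpha>} = {}"
      using True by auto
    ultimately have "(\<Sum>i | i \<in> I \<and> \<bar>f i\<bar> = \<alpha>. f i ^ m) =
      (\<Sum>i | i \<in> I \<and> f i = \<alpha>. f i ^ m) + (\<Sum>i | i \<in> I \<and> f i = - \<alpha>. f i ^ m)"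
      using assms(1) by (simp add: sum.union_disjoint)
    also have "\<dots> = of_int (balance f I \<alpha>) * \<alpha> ^ m"
      using assms(2) by (simp add: balance_def power_minus_odd algebra_simps)
    finally show ?thesis using True by simp
  next
    case False
    with that have "\<alpha> = 0" by auto
    with assms(2) show ?thesis by (auto intro!: sum.neutral simp: odd_pos)
  qed
  have "(\<Sum>i\<in>I. f i ^ m) = (\<Sum>\<alpha>\<in>?T. \<Sum>i | i \<in> I \<and> \<bar>f i\<bar> = \<alpha>. f i ^ m)"
    by (rule sum.image_gen[OF assms(1)])
  also have "\<dots> = (\<Sum>\<alpha>\<in>?T. if \<alpha> > 0 then of_int (balance f I \<alpha>) * \<alpha> ^ m else 0)"
    using level by (rule sum.cong[OF refl])
  also have "\<dots> = (\<Sum>\<alpha>\<in>?P. of_int (balance f I \<alpha>) * \<alpha> ^ m)"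
  proof (rule sum.mono_neutral_cong)
    fix \<alpha> assume "\<alpha> \<in> ?P - ?T"
    then have "{i \<in> I. f i = \<alpha>} = {}" and "{i \<in> I. f i = - \<alpha>} = {}"
      by (auto simp: image_iff)
    then have "balance f I \<alpha> = 0" unfolding balance_def by (simp only:)
    then show "of_int (balance f I \<alpha>) * \<alpha> ^ m = 0" by simp
  qed (use assms(1) finite_nonzero_balance[of I f] in auto)
  finally show ?thesis .
qed

lemma odd_root_tendsto_sgn:
  fixes u :: "nat \<Rightarrow> real"
  assumes "u \<longlonglongrightarrow> d" "d \<noteq> 0"
  shows "(\<lambda>p. root (2*p+1) (u p)) \<longlonglongrightarrow> sgn d"
proof -
  have pos: "(\<lambda>p. root (2*p+1) (w p)) \<longlonglongrightarrow> 1" if w: "w \<longlonglongrightarrow> e" and e: "e > 0"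
    for w :: "nat \<Rightarrow> real" and e
  proof -
    have "(\<lambda>p. 1 / real (2*p+1)) \<longlonglongrightarrow> 0"
      using LIMSEQ_subseq_LIMSEQ[OF lim_const_over_n[of 1], of "\<lambda>p. 2*p+1"]
      by (simp add: strict_mono_def o_def)
    then have "(\<lambda>p. w p powr (1 / real (2*p+1))) \<longlonglongrightarrow> e powr 0"
      using w e by (intro tendsto_powr) auto
    moreover have "\<forall>\<^sub>F p in sequentially. w p powr (1 / real (2*p+1)) = root (2*p+1) (w p)"
      using order_tendstoD(1)[OF w e]
      by eventually_elim (simp add: root_powr_inverse)
    ultimately show ?thesis
      using e by (simp add: filterlim_cong[OF refl refl])
  qed
  show ?thesis
  proof (cases "d > 0")
    case True
    then show ?thesis using pos[OF assms(1)] by simp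
  next
    case False
    then have "(\<lambda>p. root (2*p+1) (- u p)) \<longlonglongrightarrow> 1"
      using assms by (intro pos[OF tendsto_minus]) auto
    from tendsto_minus[OF this] show ?thesis
      using False assms(2) by (simp add: real_root_minus)
  qed
qed

text \<open>If every balance is zero, all these sums vanish.  Otherwise, after division by the \<open>m\<close>-th power
  of the largest unbalanced absolute value (\<open>m = 2 * p + 1\<close>), the sum tends to the balance of that
  value, a nonzero number; hence the \<open>m\<close>-th roots of the quotients tend to the sign of the balance.\<close>

lemma root_power_sum_tendsto_boxsum:
  fixes f :: "'i \<Rightarrow> real"
  assumes fin: "finite I"
  shows "(\<lambda>p. root (2*p+1) (\<Sum>i\<in>I. f i ^ (2*p+1))) \<longlonglongrightarrow> boxsum f I"
proof -
  let ?P = "{\<alpha>. \<alpha> > 0 \<and> balance f I \<alpha> \<noteq> 0}"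
  let ?\<beta> = "balance f I"
  have finP: "finite ?P" by (rule finite_nonzero_balance[OF fin])
  have sum_eq: "(\<Sum>i\<in>I. f i ^ (2*p+1)) = (\<Sum>\<alpha>\<in>?P. of_int (?\<beta> \<alpha>) * \<alpha> ^ (2*p+1))" for p
    by (rule sum_odd_power_eq_sum_balance[OF fin]) simp
  show ?thesis
  proof (cases "?P = {}")
    case True
    then have "\<forall>\<alpha>>0. ?\<beta> \<alpha> = 0" by auto
    then show ?thesis by (simp only: sum_eq True boxsum_def) simp
  next
    case False
    define a where "a = Max ?P"
    have "a \<in> ?P" unfolding a_def using finP False by (rule Max_in)
    then have a: "a > 0" "?\<beta> a \<noteq> 0" by auto
    have a_max: "\<alpha> \<le> a" if "\<alpha> \<in> ?P" for \<alpha> unfolding a_def using finP that by (rule Max_ge)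
    have box: "boxsum f I = a * sgn (of_int (?\<beta> a))"
      using False a by (auto simp: boxsum_def Let_def a_def sgn_if)
    define u where "u p = (\<Sum>\<alpha>\<in>?P. of_int (?\<beta> \<alpha>) * (\<alpha> / a) ^ (2*p+1))" for p
    have "u \<longlonglongrightarrow> (\<Sum>\<alpha>\<in>?P. of_int (?\<beta> \<alpha>) * (if \<alpha> = a then 1 else 0))"
      unfolding u_def
    proof (intro tendsto_sum tendsto_mult tendsto_const)
      fix \<alpha> assume \<alpha>: "\<alpha> \<in> ?P"
      show "(\<lambda>p. (\<alpha> / a) ^ (2*p+1)) \<longlonglongrightarrow> (if \<alpha> = a then 1 else 0)"
      proof (cases "\<alpha> = a")
        case True
        then show ?thesis using a by simp
      next
        case False
        then have "0 \<le> \<alpha> / a" "\<alpha> / a < 1" using \<alpha> a_max[OF \<alpha>] a by auto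
        then have "(\<lambda>p. (\<alpha> / a) ^ p) \<longlonglongrightarrow> 0" by (rule LIMSEQ_realpow_zero)
        moreover have "strict_mono (\<lambda>p::nat. 2*p+1)" by (rule strict_monoI) simp
        ultimately have "((\<lambda>p. (\<alpha> / a) ^ p) \<circ> (\<lambda>p. 2*p+1)) \<longlonglongrightarrow> 0"
          by (rule LIMSEQ_subseq_LIMSEQ)
        then show ?thesis using False by (simp add: o_def)
      qed
    qed
    also have "(\<Sum>\<alpha>\<in>?P. of_int (?\<beta> \<alpha>) * (if \<alpha> = a then 1 else 0)) = (of_int (?\<beta> a) :: real)"
      using finP a by (simp add: if_distrib cong: if_cong)
    finally have "(\<lambda>p. a * root (2*p+1) (u p)) \<longlonglongrightarrow> boxsum f I"
      unfolding box using a(2) by (intro tendsto_mult tendsto_const odd_root_tendsto_sgn) auto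
    moreover have "a * root (2*p+1) (u p) = root (2*p+1) (\<Sum>i\<in>I. f i ^ (2*p+1))" for p
    proof -
      have "(\<Sum>i\<in>I. f i ^ (2*p+1)) = a ^ (2*p+1) * u p"
        unfolding sum_eq u_def sum_distrib_left
        by (rule sum.cong[OF refl]) (use a in \<open>simp add: power_divide\<close>)
      moreover have "root (2*p+1) (a ^ (2*p+1)) = a"
        by (rule odd_real_root_power_cancel) simp
      ultimately show ?thesis by (simp only: real_root_mult)
    qed
    ultimately show ?thesis by simp
  qed
qed

section \<open>Limit determinants and Cramer's rule\<close>

definition entrywise_power :: "nat \<Rightarrow> real^'n^'m \<Rightarrow> real^'n^'m" where
  "entrywise_power m A = (\<chi> i j. (A $ i $ j) ^ m)"

lemma root_det_entrywise_power_tendsto_det_inf: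
  fixes A :: "real^'n^'n"
  shows "(\<lambda>p. root (2*p+1) (det (entrywise_power (2*p+1) A))) \<longlonglongrightarrow> det_inf A"
proof -
  have sgn: "of_int (sign \<sigma>) ^ (2*p+1) = (of_int (sign \<sigma>) :: real)"
    for p and \<sigma> :: "'n \<Rightarrow> 'n"
    by (cases \<sigma> rule: sign_cases) auto
  have "det (entrywise_power (2*p+1) A) =
    (\<Sum>\<sigma> | \<sigma> permutes UNIV. (of_int (sign \<sigma>) * (\<Prod>i\<in>UNIV. A $ i $ \<sigma> i)) ^ (2*p+1))" for p
    unfolding det_def entrywise_power_def power_mult_distrib sgn prod_power_distrib
    by simp
  then show ?thesis
    unfolding det_inf_def by (simp only:) (rule root_power_sum_tendsto_boxsum, simp)
qed

lemma cramer_quotients_in_Ls: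
  fixes A :: "real^'n^'n"
  assumes nz: "det_inf A \<noteq> 0"
  shows "(\<chi> i. det_inf (replace_col A i b) / det_inf A) \<in> Ls (\<lambda>p. {x. pmult p A x = b})"
proof -
  define D where "D p B = root (2*p+1) (det (entrywise_power (2*p+1) B))" for p and B :: "real^'n^'n"
  have D_lim: "(\<lambda>p. D p B) \<longlonglongrightarrow> det_inf B" for B
    unfolding D_def by (rule root_det_entrywise_power_tendsto_det_inf)
  define x where "x p = (\<chi> i. D p (replace_col A i b) / D p A)" for p
  have "\<forall>\<^sub>F p in sequentially. D p A \<noteq> 0"
    by (rule tendsto_imp_eventually_ne[OF D_lim nz])
  then obtain K where K: "\<And>p. p \<ge> K \<Longrightarrow> D p A \<noteq> 0"
    by (auto simp: eventually_sequentially)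
  have solves: "pmult p A (x p) = b" if "p \<ge> K" for p
  proof -
    let ?m = "2*p+1"
    let ?A = "entrywise_power ?m A" and ?b = "\<chi> i. b $ i ^ ?m"
    have D_pow: "D p B ^ ?m = det (entrywise_power ?m B)" for B
      unfolding D_def by (rule odd_real_root_pow) simp
    have det_nz: "det ?A \<noteq> 0" using K[OF that] by (auto simp: D_def)
    have repl: "entrywise_power ?m (replace_col A k b) =
      (\<chi> i j. if j = k then ?b $ i else ?A $ i $ j)" for k
      by (simp add: entrywise_power_def replace_col_def vec_eq_iff)
    have "(\<chi> k. x p $ k ^ ?m) =
      (\<chi> k. det (\<chi> i j. if j = k then ?b $ i else ?A $ i $ j) / det ?A)"
      unfolding repl[symmetric] by (simp only: x_def vec_lambda_beta power_divide D_pow)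
    then have "?A *v (\<chi> k. x p $ k ^ ?m) = ?b"
      using cramer[OF det_nz] by blast
    then show ?thesis
      unfolding pmult_eq_iff
      by (simp add: matrix_vector_mult_def vec_eq_iff entrywise_power_def)
  qed
  have x_lim: "x \<longlonglongrightarrow> (\<chi> i. det_inf (replace_col A i b) / det_inf A)"
    unfolding x_def by (intro tendsto_vec_lambda tendsto_divide D_lim nz)
  show ?thesis
    unfolding Ls_def
  proof (intro CollectI exI conjI allI)
    show "strict_mono (\<lambda>k. k + K)" by (rule strict_monoI) simp
    show "pmult (k + K) A (x (k + K)) = b" for k by (rule solves) simp
    show "(\<lambda>k. x (k + K)) \<longlonglongrightarrow> (\<chi> i. det_inf (replace_col A i b) / det_inf A)"
      using x_lim by (rule LIMSEQ_ignore_initial_segment)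
  qed
qed

theorem proposition5p1p2:
  fixes A :: "real^'n^'n" and b :: "real^'n"
  shows "(\<forall>x \<in> Ls (\<lambda>p. {x. pmult p A x = b}). box_minus A x \<le> b \<and> box_plus A x \<ge> b) \<and>
    (det_inf A \<noteq> 0 \<longrightarrow>
      (let x = (\<Sum>i\<in>UNIV. (det_inf (replace_col A i b) / det_inf A) *\<^sub>R axis i 1)
       in box_minus A x \<le> b \<and> box_plus A x \<ge> b))"
proof -
  have "(\<Sum>i\<in>UNIV. (det_inf (replace_col A i b) / det_inf A) *\<^sub>R axis i 1) =
    (\<chi> i. det_inf (replace_col A i b) / det_inf A)"
    using basis_expansion[of "\<chi> i. det_inf (replace_col A i b) / det_inf A"]
    by (simp add: scalar_mult_eq_scaleR)
  then show ?thesis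
    using Ls_pmult_solutions_imp_box_system[of _ A b] cramer_quotients_in_Ls[of A b]
    by (simp add: Let_def)
qed

end
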